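(* Let $G$ be the discrete-time LTI system $$x(k+1)=Ax(k)+B_1w(k)+B_2d(k),\quad v(k)=C_1x(k)+D_{11}w(k)+D_{12}d(k),\quad e(k)=C_2x(k)+D_{21}w(k)+D_{22}d(k),$$ with $x(k)\in\mathbb{R}^{n_x}$, $w(k),v(k)\in\mathbb{R}^m$, $d(k)\in\mathbb{R}^{n_d}$, $e(k)\in\mathbb{R}^{n_e}$, and let $F_U(G,\Delta_\Phi)$ be its feedback interconnection with the repeated ReLU, i.e. $w=\Delta_\Phi(v)$. Assume the interconnection is well-posed. Let $N\ge 0$ be an integer, let $\{Q^1_i\}_{i=0}^N$, $\{Q^2_i\}_{i=0}^N$, $\{Q^3_i\}_{i=-N}^{-1}$, $\{Q^3_i\}_{i=1}^{N}$ be matrices in $\mathbb{R}_{\ge 0}^{m\times m}$ (entrywise non-negative), with $Q^1_i$ and $Q^2_i$ symmetric for $i=0,\dots,N$, and let $Q^3_0\in\mathbb{R}^{m\times m}$ be a Metzler matrix. Define $$M_j:=\begin{bmatrix} Q^j_0 & Q^j_1 & \cdots & Q^j_N \\ Q^j_1 & 0 & \cdots & 0 \\ \vdots & \vdots & & \vdots \\ Q^j_N & 0 & \cdots & 0\end{bmatrix}\ (j=1,2),\qquad M_3:=\begin{bmatrix} Q^3_0 & Q^3_1 & \cdots & Q^3_N \\ Q^3_{-1} & 0 & \cdots & 0 \\ \vdots & \vdots & & \vdots \\ Q^3_{-N} & 0 & \cdots & 0\end{bmatrix},$$ $$M:=\begin{bmatrix} M_1 & -M_3^\top-M_1 \\ -M_3-M_1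 & M_1+M_2+M_3+M_3^\top\end{bmatrix}.$$ If there exist a positive semidefinite matrix $P$ and a scalar $\gamma\ge 0$ such that $L(P,M,\gamma^2)\prec 0$, then $F_U(G,\Delta_\Phi)$ is internally stable and $\|F_U(G,\Delta_\Phi)\|_{2\to2}<\gamma$.
   Context: Signals are sequences indexed by $k\in\mathbb{N}=\{0,1,2,\dots\}$; $\ell_2^n$ is the space of square-summable sequences $\mathbb{N}\to\mathbb{R}^n$ with norm $\|v\|_2=(\sum_k v(k)^\top v(k))^{1/2}$, and $\ell_{2e}^n$ is the space of all sequences $\mathbb{N}\to\mathbb{R}^n$. Repeated ReLU: $\phi(s)=0$ for $s<0$, $\phi(s)=s$ for $s\ge0$; $\Phi:\mathbb{R}^m\to\mathbb{R}^m_{\ge0}$ applies $\phi$ entrywise; $\Delta_\Phi:\ell_{2e}^m\to\ell_{2e}^m$ is $(\Delta_\Phi(v))(k)=\Phi(v(k))$. A matrix is Metzler if its off-diagonal entries are non-negative. Well-posedness: for all $x\in\mathbb{R}^{n_x}$ and $d\in\mathbb{R}^{n_d}$ the equation $v=C_1x+D_{11}\Phi(v)+D_{12}d$ has a unique solution $v\in\mathbb{R}^m$. Consequently, for every $x(0)$ and every $d\in\ell_{2e}^{n_d}$ there are unique signals $x,v,w,e$ solving the interconnection. Internal stability: with $d=0$, $x(k)\to0$ from any initial condition $x(0)$; in other words, $x=0$ is a globally asymptotically stable equilibrium when there is no external input. Induced gain: $\|F_U(G,\Delta_\Phi)\|_{2\to2}$ is the infimum of all $\gamma<\infty$ such that for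 every $d\in\ell_2^{n_d}$, with $x(0)=0$, the output satisfies $\|e\|_2\le\gamma\|d\|_2$. Filter: $\Psi_N$ is the FIR filter with inputs $(v,w)$ whose output from zero initial conditions is $r(k)=[v(k)^\top,\dots,v(k-N)^\top,w(k)^\top,\dots,w(k-N)^\top]^\top$ (with $v(j)=w(j)=0$ for $j<0$). Fix a state-space realization $$\psi(k+1)=A_\psi\psi(k)+B_{\psi1}v(k)+B_{\psi2}w(k),\qquad r(k)=C_\psi\psi(k)+D_{\psi1}v(k)+D_{\psi2}w(k).$$ The augmented system with state $\hat x=[x^\top\ \psi^\top]^\top$, inputs $(w,d)$ and outputs $(r,e)$ has matrices $$\hat A=\begin{bmatrix} A & 0 \\ B_{\psi1}C_1 & A_\psi\end{bmatrix},\ \hat B_1=\begin{bmatrix} B_1 \\ B_{\psi1}D_{11}+B_{\psi2}\end{bmatrix},\ \hat B_2=\begin{bmatrix} B_2 \\ B_{\psi1}D_{12}\end{bmatrix},$$ $$\hat C_1=\begin{bmatrix} D_{\psi1}C_1 & C_\psi\end{bmatrix},\ \hat C_2=\begin{bmatrix} C_2 & 0\end{bmatrix},\ \hat D_{11}=D_{\psi1}D_{11}+D_{\psi2},\ \hat D_{12}=D_{\psi1}D_{12},\ \hat D_{21}=D_{21},\ \hat D_{22}=D_{22}.$$ For a symmetric matrix $P$ of the size of $\hat A$, define $$L(P,M,\gamma^2):=\begin{bmatrix} \hat A^\top P\hat A-P & \hat A^\top P\hat B_1 & \hat A^\top P\hat B_2 \\ \hat B_1^\top P\hat A & \hat B_1^\top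 P\hat B_1 & \hat B_1^\top P\hat B_2 \\ \hat B_2^\top P\hat A & \hat B_2^\top P\hat B_1 & \hat B_2^\top P\hat B_2-\gamma^2I\end{bmatrix}+\begin{bmatrix} \hat C_2^\top \\ \hat D_{21}^\top \\ \hat D_{22}^\top\end{bmatrix}\begin{bmatrix} \hat C_2^\top \\ \hat D_{21}^\top \\ \hat D_{22}^\top\end{bmatrix}^\top+\begin{bmatrix} \hat C_1^\top \\ \hat D_{11}^\top \\ \hat D_{12}^\top\end{bmatrix}M\begin{bmatrix} \hat C_1^\top \\ \hat D_{11}^\top \\ \hat D_{12}^\top\end{bmatrix}^\top .$$ $X\prec0$ means that the symmetric matrix $X$ is negative definite. *)

theory Defs
  imports
    Complex_Main
    "HOL-Library.Extended_Real"
    "Jordan_Normal_Form.Matrix"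
begin

type_synonym signal = "nat \<Rightarrow> real vec"

definition l2e :: "nat \<Rightarrow> signal set" where
  "l2e n = {v. \<forall>k. v k \<in> carrier_vec n}"

definition l2 :: "nat \<Rightarrow> signal set" where
  "l2 n = {v \<in> l2e n. summable (\<lambda>k. v k \<bullet> v k)}"

definition l2_norm :: "signal \<Rightarrow> real" where
  "l2_norm v = sqrt (\<Sum>k. v k \<bullet> v k)"

definition eucl_norm :: "real vec \<Rightarrow> real" where
  "eucl_norm x = sqrt (x \<bullet> x)"

definition nonneg_square_mat :: "nat \<Rightarrow> real mat \<Rightarrow> bool" where
  "nonneg_square_mat n X \<longleftrightarrow> X \<in> carrier_mat n n \<and> (\<forall>i<n. \<forall>j<n. 0 \<le> X $$ (i, j))"

definition Metzler_mat :: "nat \<Rightarrow> real mat \<Rightarrow> bool" where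
  "Metzler_mat n X \<longleftrightarrow> X \<in> carrier_mat n n \<and> (\<forall>i<n. \<forall>j<n. i \<noteq> j \<longrightarrow> 0 \<le> X $$ (i, j))"

definition sym_mat :: "nat \<Rightarrow> real mat \<Rightarrow> bool" where
  "sym_mat n X \<longleftrightarrow> X \<in> carrier_mat n n \<and> X\<^sup>T = X"

definition psd_mat :: "nat \<Rightarrow> real mat \<Rightarrow> bool" where
  "psd_mat n X \<longleftrightarrow> sym_mat n X \<and> (\<forall>x \<in> carrier_vec n. 0 \<le> x \<bullet> (X *\<^sub>v x))"

definition negdef_mat :: "nat \<Rightarrow> real mat \<Rightarrow> bool" where
  "negdef_mat n X \<longleftrightarrow> sym_mat n X \<and>
     (\<forall>x \<in> carrier_vec n. x \<noteq> 0\<^sub>v n \<longrightarrow> x \<bullet> (X *\<^sub>v x) < 0)"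

definition append_cols :: "real mat \<Rightarrow> real mat \<Rightarrow> real mat" where
  "append_cols X Y = four_block_mat X Y (0\<^sub>m 0 (dim_col X)) (0\<^sub>m 0 (dim_col Y))"

definition block_mat3 ::
  "real mat \<Rightarrow> real mat \<Rightarrow> real mat \<Rightarrow> real mat \<Rightarrow> real mat \<Rightarrow> real mat \<Rightarrow>
   real mat \<Rightarrow> real mat \<Rightarrow> real mat \<Rightarrow> real mat" where
  "block_mat3 X11 X12 X13 X21 X22 X23 X31 X32 X33 =
     four_block_mat X11 (append_cols X12 X13) (X21 @\<^sub>r X31) (four_block_mat X22 X23 X32 X33)"

definition relu :: "real \<Rightarrow> real" where
  "relu s = (if s < 0 then 0 else s)"

definition relu_vec :: "real vec \<Rightarrow> real vec" where
  "relu_vec v = map_vec relu v"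

definition Delta_relu :: "signal \<Rightarrow> signal" where
  "Delta_relu v = (\<lambda>k. relu_vec (v k))"

record lti =
  sys_A :: "real mat"
  sys_B1 :: "real mat"
  sys_B2 :: "real mat"
  sys_C1 :: "real mat"
  sys_D11 :: "real mat"
  sys_D12 :: "real mat"
  sys_C2 :: "real mat"
  sys_D21 :: "real mat"
  sys_D22 :: "real mat"

definition lti_dims :: "nat \<Rightarrow> nat \<Rightarrow> nat \<Rightarrow> nat \<Rightarrow> lti \<Rightarrow> bool" where
  "lti_dims nx m nd ne G \<longleftrightarrow>
     sys_A G \<in> carrier_mat nx nx \<and> sys_B1 G \<in> carrier_mat nx m \<and> sys_B2 G \<in> carrier_mat nx nd \<and>
     sys_C1 G \<in> carrier_mat m nx \<and> sys_D11 G \<in> carrier_mat m m \<and> sys_D12 G \<in> carrier_mat m nd \<and>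
     sys_C2 G \<in> carrier_mat ne nx \<and> sys_D21 G \<in> carrier_mat ne m \<and> sys_D22 G \<in> carrier_mat ne nd"

definition well_posed :: "nat \<Rightarrow> nat \<Rightarrow> nat \<Rightarrow> lti \<Rightarrow> bool" where
  "well_posed nx m nd G \<longleftrightarrow>
     (\<forall>x \<in> carrier_vec nx. \<forall>d \<in> carrier_vec nd.
        \<exists>!v. v \<in> carrier_vec m \<and>
             v = sys_C1 G *\<^sub>v x + sys_D11 G *\<^sub>v relu_vec v + sys_D12 G *\<^sub>v d)"

definition interconnection ::
  "nat \<Rightarrow> nat \<Rightarrow> nat \<Rightarrow> nat \<Rightarrow> lti \<Rightarrow> signal \<Rightarrow> signal \<Rightarrow> signal \<Rightarrow> signal \<Rightarrow> signal \<Rightarrow> bool" where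
  "interconnection nx m nd ne G d x v w e \<longleftrightarrow>
     d \<in> l2e nd \<and> x \<in> l2e nx \<and> v \<in> l2e m \<and> w \<in> l2e m \<and> e \<in> l2e ne \<and>
     (\<forall>k. x (Suc k) = sys_A G *\<^sub>v x k + sys_B1 G *\<^sub>v w k + sys_B2 G *\<^sub>v d k) \<and>
     (\<forall>k. v k = sys_C1 G *\<^sub>v x k + sys_D11 G *\<^sub>v w k + sys_D12 G *\<^sub>v d k) \<and>
     (\<forall>k. e k = sys_C2 G *\<^sub>v x k + sys_D21 G *\<^sub>v w k + sys_D22 G *\<^sub>v d k) \<and>
     w = Delta_relu v"

text \<open>Global asymptotic stability of the origin for zero external input: attractivity from every
  initial state together with Lyapunov stability. The latter contains that the origin is an
  equilibrium (take the initial state zero).\<close>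

definition internally_stable :: "nat \<Rightarrow> nat \<Rightarrow> nat \<Rightarrow> nat \<Rightarrow> lti \<Rightarrow> bool" where
  "internally_stable nx m nd ne G \<longleftrightarrow>
     (\<forall>x v w e. interconnection nx m nd ne G (\<lambda>k. 0\<^sub>v nd) x v w e \<longrightarrow>
        (\<lambda>k. eucl_norm (x k)) \<longlonglongrightarrow> 0) \<and>
     (\<forall>\<epsilon>>0. \<exists>\<delta>>0. \<forall>x v w e. interconnection nx m nd ne G (\<lambda>k. 0\<^sub>v nd) x v w e \<longrightarrow>
        eucl_norm (x 0) < \<delta> \<longrightarrow> (\<forall>k. eucl_norm (x k) < \<epsilon>))"

text \<open>The gain is extended-real valued: it is \<open>\<infinity>\<close> if no finite bound exists. If
  \<open>nd > 0\<close>, then no negative \<open>\<gamma>\<close> is a bound, so the gain is non-negative.\<close>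

definition induced_gain :: "nat \<Rightarrow> nat \<Rightarrow> nat \<Rightarrow> nat \<Rightarrow> lti \<Rightarrow> ereal" where
  "induced_gain nx m nd ne G =
     Inf {ereal \<gamma> | \<gamma>. \<forall>d \<in> l2 nd. \<forall>x v w e.
            interconnection nx m nd ne G d x v w e \<longrightarrow> x 0 = 0\<^sub>v nx \<longrightarrow>
            e \<in> l2 ne \<and> l2_norm e \<le> \<gamma> * l2_norm d}"

definition lag_stack :: "nat \<Rightarrow> nat \<Rightarrow> signal \<Rightarrow> nat \<Rightarrow> real vec" where
  "lag_stack m N u k =
     vec ((N + 1) * m) (\<lambda>i. if i div m \<le> k then u (k - i div m) $ (i mod m) else 0)"

definition fir_output :: "nat \<Rightarrow> nat \<Rightarrow> signal \<Rightarrow> signal \<Rightarrow> signal" where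
  "fir_output m N v w k = lag_stack m N v k @\<^sub>v lag_stack m N w k"

record filter_ss =
  flt_A :: "real mat"
  flt_B1 :: "real mat"
  flt_B2 :: "real mat"
  flt_C :: "real mat"
  flt_D1 :: "real mat"
  flt_D2 :: "real mat"

definition filter_dims :: "nat \<Rightarrow> nat \<Rightarrow> nat \<Rightarrow> filter_ss \<Rightarrow> bool" where
  "filter_dims np m nr F \<longleftrightarrow>
     flt_A F \<in> carrier_mat np np \<and> flt_B1 F \<in> carrier_mat np m \<and> flt_B2 F \<in> carrier_mat np m \<and>
     flt_C F \<in> carrier_mat nr np \<and> flt_D1 F \<in> carrier_mat nr m \<and> flt_D2 F \<in> carrier_mat nr m"

text \<open>The state dimension \<open>np\<close> is arbitrary (no minimality), and may be \<open>0\<close>,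
  as for the static filter obtained for \<open>N = 0\<close>.\<close>

definition realizes_fir :: "nat \<Rightarrow> nat \<Rightarrow> nat \<Rightarrow> filter_ss \<Rightarrow> bool" where
  "realizes_fir np m N F \<longleftrightarrow>
     filter_dims np m (2 * ((N + 1) * m)) F \<and>
     (\<forall>v \<in> l2e m. \<forall>w \<in> l2e m. \<forall>\<psi>.
        \<psi> 0 = 0\<^sub>v np \<longrightarrow>
        (\<forall>k. \<psi> (Suc k) = flt_A F *\<^sub>v \<psi> k + flt_B1 F *\<^sub>v v k + flt_B2 F *\<^sub>v w k) \<longrightarrow>
        (\<forall>k. flt_C F *\<^sub>v \<psi> k + flt_D1 F *\<^sub>v v k + flt_D2 F *\<^sub>v w k = fir_output m N v w k))"

definition hat_A :: "lti \<Rightarrow> filter_ss \<Rightarrow> real mat" where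
  "hat_A G F = four_block_mat (sys_A G) (0\<^sub>m (dim_row (sys_A G)) (dim_col (flt_A F)))
                              (flt_B1 F * sys_C1 G) (flt_A F)"

definition hat_B1 :: "lti \<Rightarrow> filter_ss \<Rightarrow> real mat" where
  "hat_B1 G F = sys_B1 G @\<^sub>r (flt_B1 F * sys_D11 G + flt_B2 F)"

definition hat_B2 :: "lti \<Rightarrow> filter_ss \<Rightarrow> real mat" where
  "hat_B2 G F = sys_B2 G @\<^sub>r (flt_B1 F * sys_D12 G)"

definition hat_C1 :: "lti \<Rightarrow> filter_ss \<Rightarrow> real mat" where
  "hat_C1 G F = append_cols (flt_D1 F * sys_C1 G) (flt_C F)"

definition hat_C2 :: "lti \<Rightarrow> filter_ss \<Rightarrow> real mat" where
  "hat_C2 G F = append_cols (sys_C2 G) (0\<^sub>m (dim_row (sys_C2 G)) (dim_col (flt_A F)))"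

definition hat_D11 :: "lti \<Rightarrow> filter_ss \<Rightarrow> real mat" where
  "hat_D11 G F = flt_D1 F * sys_D11 G + flt_D2 F"

definition hat_D12 :: "lti \<Rightarrow> filter_ss \<Rightarrow> real mat" where
  "hat_D12 G F = flt_D1 F * sys_D12 G"

definition hat_D21 :: "lti \<Rightarrow> filter_ss \<Rightarrow> real mat" where
  "hat_D21 G F = sys_D21 G"

definition hat_D22 :: "lti \<Rightarrow> filter_ss \<Rightarrow> real mat" where
  "hat_D22 G F = sys_D22 G"

definition lmi_mat :: "lti \<Rightarrow> filter_ss \<Rightarrow> real mat \<Rightarrow> real mat \<Rightarrow> real \<Rightarrow> real mat" where
  "lmi_mat G F P M g =
    (let A = hat_A G F; B1 = hat_B1 G F; B2 = hat_B2 G F;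
         E = (hat_C2 G F)\<^sup>T @\<^sub>r (hat_D21 G F)\<^sup>T @\<^sub>r (hat_D22 G F)\<^sup>T;
         R = (hat_C1 G F)\<^sup>T @\<^sub>r (hat_D11 G F)\<^sup>T @\<^sub>r (hat_D12 G F)\<^sup>T
     in block_mat3
          (A\<^sup>T * P * A - P)  (A\<^sup>T * P * B1)   (A\<^sup>T * P * B2)
          (B1\<^sup>T * P * A)     (B1\<^sup>T * P * B1)  (B1\<^sup>T * P * B2)
          (B2\<^sup>T * P * A)     (B2\<^sup>T * P * B1)  (B2\<^sup>T * P * B2 - g \<cdot>\<^sub>m 1\<^sub>m (dim_col B2))
        + E * E\<^sup>T + R * M * R\<^sup>T)"

text \<open>Block \<open>(p, q)\<close> is \<open>R q\<close> in the first block row, \<open>C p\<close> in the first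
  block column and zero elsewhere; \<open>C 0\<close> is not used.\<close>

definition arrow_mat :: "nat \<Rightarrow> nat \<Rightarrow> (nat \<Rightarrow> real mat) \<Rightarrow> (nat \<Rightarrow> real mat) \<Rightarrow> real mat" where
  "arrow_mat m N R C =
     mat ((N + 1) * m) ((N + 1) * m)
       (\<lambda>(i, j). if i div m = 0 then R (j div m) $$ (i mod m, j mod m)
                 else if j div m = 0 then C (i div m) $$ (i mod m, j mod m)
                 else 0)"

definition multiplier ::
  "nat \<Rightarrow> nat \<Rightarrow> (nat \<Rightarrow> real mat) \<Rightarrow> (nat \<Rightarrow> real mat) \<Rightarrow> (int \<Rightarrow> real mat) \<Rightarrow> real mat" where
  "multiplier m N Q1 Q2 Q3 =
    (let M1 = arrow_mat m N Q1 Q1;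
         M2 = arrow_mat m N Q2 Q2;
         M3 = arrow_mat m N (\<lambda>i. Q3 (int i)) (\<lambda>i. Q3 (- int i))
     in four_block_mat M1 (- M3\<^sup>T - M1) (- M3 - M1) (M1 + M2 + M3 + M3\<^sup>T))"

end

(* With w = relu(v) and z = w - v, both w and z are entrywise non-negative and w_i z_i = 0 at every
   time. On the stacked signals V, W and Z = W - V the multiplier form equals
   Z^T M_1 Z + W^T M_2 W + 2 W^T M_3 Z, and the only entries of M_3 that may be negative, those on
   the diagonal, meet w_i z_i = 0; hence the form is non-negative at each time. The LMI then makes
   the storage function of the augmented system dissipate with a margin epsilon. Summing over time
   from zero filter state bounds |e|^2 + epsilon |x|^2 by c |x(0)|^2 + (gamma^2 - epsilon) |d|^2,
   which yields stability for d = 0 and the gain bound for x(0) = 0. *)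

theory Submission
  imports Defs "Jordan_Normal_Form.Determinant"
begin

section \<open>Scalar products and matrix-vector products\<close>

lemma scalar_prod_self_nonneg: "0 \<le> (x :: real vec) \<bullet> x"
  by (simp add: scalar_prod_def sum_nonneg)

text \<open>The side conditions of this rule and its companions are equations between dimensions,
  not carrier memberships, so rewriting needs no dimension to be guessed.\<close>

lemma scalar_prod_add_right_dim:
  "dim_vec u = dim_vec v \<Longrightarrow> x \<bullet> (u + v) = x \<bullet> u + (x \<bullet> v :: real)"
  by (simp add: scalar_prod_def algebra_simps sum.distrib)

lemma scalar_prod_add_left_dim:
  "dim_vec u = dim_vec x \<Longrightarrow> dim_vec v = dim_vec x \<Longrightarrow> (u + v) \<bullet> x = u \<bullet> x + (v \<bullet> x :: real)"
  by (simp add: scalar_prod_def algebra_simps sum.distrib)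

lemma scalar_prod_diff_right_dim:
  "dim_vec u = dim_vec v \<Longrightarrow> x \<bullet> (u - v) = x \<bullet> u - (x \<bullet> v :: real)"
  by (simp add: scalar_prod_def algebra_simps sum_subtractf)

lemma scalar_prod_diff_left_dim:
  "dim_vec u = dim_vec x \<Longrightarrow> dim_vec v = dim_vec x \<Longrightarrow> (u - v) \<bullet> x = u \<bullet> x - (v \<bullet> x :: real)"
  by (simp add: scalar_prod_def algebra_simps sum_subtractf)

lemma scalar_prod_append_dim:
  "dim_vec a = dim_vec c \<Longrightarrow> dim_vec b = dim_vec d \<Longrightarrow>
   (a @\<^sub>v b) \<bullet> (c @\<^sub>v d) = a \<bullet> c + (b \<bullet> d :: real)"
  by (rule scalar_prod_append[of _ "dim_vec a" _ "dim_vec b"]) (auto intro: carrier_vecI)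

lemma mult_mat_vec_add_dim:
  "dim_vec u = dim_vec v \<Longrightarrow> (A :: real mat) *\<^sub>v (u + v) = A *\<^sub>v u + A *\<^sub>v v"
  by (intro eq_vecI) (auto simp: scalar_prod_add_right_dim)

lemma mult_mat_vec_diff_dim:
  "dim_vec u = dim_vec v \<Longrightarrow> (A :: real mat) *\<^sub>v (u - v) = A *\<^sub>v u - A *\<^sub>v v"
  by (intro eq_vecI) (auto simp: scalar_prod_diff_right_dim)

lemma add_mat_mult_vec_dim:
  "dim_row A = dim_row B \<Longrightarrow> dim_col A = dim_vec x \<Longrightarrow> dim_col B = dim_vec x \<Longrightarrow>
   ((A :: real mat) + B) *\<^sub>v x = A *\<^sub>v x + B *\<^sub>v x"
  by (intro eq_vecI) (auto simp: scalar_prod_add_left_dim)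

lemma diff_mat_mult_vec_dim:
  "dim_row A = dim_row B \<Longrightarrow> dim_col A = dim_vec x \<Longrightarrow> dim_col B = dim_vec x \<Longrightarrow>
   ((A :: real mat) - B) *\<^sub>v x = A *\<^sub>v x - B *\<^sub>v x"
  by (intro eq_vecI) (auto simp: scalar_prod_def left_diff_distrib sum_subtractf)

lemma smult_mat_mult_vec_dim:
  "dim_col A = dim_vec x \<Longrightarrow> (c \<cdot>\<^sub>m (A :: real mat)) *\<^sub>v x = c \<cdot>\<^sub>v (A *\<^sub>v x)"
  by (intro eq_vecI) auto

lemma mult_mat_mult_vec_dim:
  "dim_col A = dim_row B \<Longrightarrow> dim_col B = dim_vec x \<Longrightarrow>
   ((A :: real mat) * B) *\<^sub>v x = A *\<^sub>v (B *\<^sub>v x)"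
  by (rule assoc_mult_mat_vec[of _ "dim_row A" "dim_row B" _ "dim_col B"]) (auto intro: carrier_vecI)

lemma transpose_scalar_prod_dim:
  assumes "dim_col A = dim_vec x" "dim_row A = dim_vec y"
  shows "x \<bullet> ((A :: real mat)\<^sup>T *\<^sub>v y) = (A *\<^sub>v x) \<bullet> y"
proof -
  obtain n k where A: "A \<in> carrier_mat n k" and x: "x \<in> carrier_vec k" and y: "y \<in> carrier_vec n"
    using assms by (metis carrier_mat_triv carrier_vec_dim_vec)
  have "x \<bullet> (A\<^sup>T *\<^sub>v y) = (A\<^sup>T *\<^sub>v y) \<bullet> x"
    by (rule comm_scalar_prod[OF x]) (use A y in auto)
  also have "\<dots> = y \<bullet> (A *\<^sub>v x)" by (rule transpose_vec_mult_scalar[OF A x y])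
  also have "\<dots> = (A *\<^sub>v x) \<bullet> y" by (rule comm_scalar_prod[OF y]) (use A x in auto)
  finally show ?thesis .
qed

text \<open>Normal form for quadratic-form identities: sums are distributed, matrix products become
  iterated applications, and a transpose moves to the other factor as the matrix itself.\<close>

lemmas mat_vec_expand =
  scalar_prod_add_right_dim scalar_prod_add_left_dim scalar_prod_diff_right_dim
  scalar_prod_diff_left_dim scalar_prod_append_dim mult_mat_vec_add_dim mult_mat_vec_diff_dim
  add_mat_mult_vec_dim diff_mat_mult_vec_dim smult_mat_mult_vec_dim mult_mat_mult_vec_dim
  transpose_scalar_prod_dim

section \<open>Bilinear and quadratic forms in coordinates\<close>

lemma bilinear_form_sum:
  assumes "(A :: real mat) \<in> carrier_mat n k" "x \<in> carrier_vec n" "y \<in> carrier_vec k"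
  shows "x \<bullet> (A *\<^sub>v y) = (\<Sum>i<n. \<Sum>j<k. x $ i * A $$ (i, j) * y $ j)"
  using assms
  by (auto simp: scalar_prod_def sum_distrib_left mult.assoc atLeast0LessThan intro!: sum.cong)

text \<open>The sign condition is placed on the whole product and not on its factors, so that a
  negative matrix entry is allowed wherever its coefficient \<open>x $ i * y $ j\<close>
  vanishes.\<close>

lemma bilinear_form_nonneg:
  assumes "(A :: real mat) \<in> carrier_mat n k" "x \<in> carrier_vec n" "y \<in> carrier_vec k"
    and "\<And>i j. i < n \<Longrightarrow> j < k \<Longrightarrow> 0 \<le> x $ i * A $$ (i, j) * y $ j"
  shows "0 \<le> x \<bullet> (A *\<^sub>v y)"
  unfolding bilinear_form_sum[OF assms(1-3)] using assms(4) by (auto intro!: sum_nonneg)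

text \<open>By the arithmetic-geometric mean inequality each product of two coordinates is at most
  \<open>x \<bullet> x\<close> in absolute value, so the absolute values of the entries of
  \<open>S\<close> can be added up.\<close>

lemma quadratic_form_bound:
  assumes S: "(S :: real mat) \<in> carrier_mat n n"
  obtains c where "c > 0" "\<And>x. x \<in> carrier_vec n \<Longrightarrow> \<bar>x \<bullet> (S *\<^sub>v x)\<bar> \<le> c * (x \<bullet> x)"
proof
  \<comment> \<open>The summand 1 keeps the constant positive even when \<open>S\<close> vanishes;
    the constant is divided by later.\<close>
  let ?c = "1 + (\<Sum>i<n. \<Sum>j<n. \<bar>S $$ (i, j)\<bar>)"
  show "?c > 0" by (intro add_pos_nonneg sum_nonneg) auto
  fix x :: "real vec" assume x: "x \<in> carrier_vec n"
  have sq: "(x $ i)\<^sup>2 \<le> x \<bullet> x" if "i < n" for i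
    using x that member_le_sum[of i "{0..<n}" "\<lambda>i. x $ i * x $ i"]
    by (auto simp: scalar_prod_def power2_eq_square)
  have le: "\<bar>x $ i * S $$ (i, j) * x $ j\<bar> \<le> \<bar>S $$ (i, j)\<bar> * (x \<bullet> x)" if "i < n" "j < n" for i j
  proof -
    have "2 * (\<bar>x $ i\<bar> * \<bar>x $ j\<bar>) \<le> (x $ i)\<^sup>2 + (x $ j)\<^sup>2"
      using sum_squares_bound[of "\<bar>x $ i\<bar>" "\<bar>x $ j\<bar>"] by simp
    then have "\<bar>x $ i\<bar> * \<bar>x $ j\<bar> \<le> x \<bullet> x"
      using sq[of i] sq[of j] that by simp
    from mult_left_mono[OF this, of "\<bar>S $$ (i, j)\<bar>"] show ?thesis
      by (simp add: abs_mult algebra_simps)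
  qed
  have "\<bar>x \<bullet> (S *\<^sub>v x)\<bar> \<le> (\<Sum>i<n. \<Sum>j<n. \<bar>S $$ (i, j)\<bar> * (x \<bullet> x))"
    unfolding bilinear_form_sum[OF S x x]
    by (intro order_trans[OF sum_abs] sum_mono) (auto intro!: le)
  also have "\<dots> \<le> ?c * (x \<bullet> x)"
    using scalar_prod_self_nonneg[of x] by (simp add: sum_distrib_right distrib_right)
  finally show "\<bar>x \<bullet> (S *\<^sub>v x)\<bar> \<le> ?c * (x \<bullet> x)" .
qed

section \<open>Uniform margin of a negative definite matrix\<close>

text \<open>A trivial kernel makes the determinant nonzero, so \<open>X\<close> is a unit of the
  matrix ring.\<close>

lemma right_inverse_if_injective:
  fixes X :: "real mat"
  assumes X: "X \<in> carrier_mat n n"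
    and inj: "\<And>x. x \<in> carrier_vec n \<Longrightarrow> X *\<^sub>v x = 0\<^sub>v n \<Longrightarrow> x = 0\<^sub>v n"
  obtains Y where "Y \<in> carrier_mat n n" "X * Y = 1\<^sub>m n"
proof -
  have "det X \<noteq> 0"
    using inj det_0_iff_vec_prod_zero[OF X] by auto
  from det_non_zero_imp_unit[OF X this, of "()"] show ?thesis
    by (auto simp: Units_def ring_mat_simps intro: that)
qed

text \<open>The bound comes from evaluating the form at \<open>x + t Y x\<close> with \<open>Y\<close> the inverse of \<open>X\<close>,
  which makes a compactness argument on the unit sphere unnecessary.\<close>

lemma negdef_mat_uniform:
  assumes "negdef_mat n X"
  obtains \<epsilon> where "\<epsilon> > 0" "\<And>x. x \<in> carrier_vec n \<Longrightarrow> x \<bullet> (X *\<^sub>v x) \<le> - \<epsilon> * (x \<bullet> x)"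
proof -
  have X: "X \<in> carrier_mat n n" and sym: "X\<^sup>T = X"
    and neg: "\<And>x. x \<in> carrier_vec n \<Longrightarrow> x \<noteq> 0\<^sub>v n \<Longrightarrow> x \<bullet> (X *\<^sub>v x) < 0"
    using assms by (auto simp: negdef_mat_def sym_mat_def)
  have nonpos: "x \<bullet> (X *\<^sub>v x) \<le> 0" if "x \<in> carrier_vec n" for x
    using neg[OF that] X by (cases "x = 0\<^sub>v n") auto
  obtain Y where Y: "Y \<in> carrier_mat n n" "X * Y = 1\<^sub>m n"
  proof (rule right_inverse_if_injective[OF X])
    fix x :: "real vec" assume x: "x \<in> carrier_vec n" and "X *\<^sub>v x = 0\<^sub>v n"
    then have "\<not> x \<bullet> (X *\<^sub>v x) < 0" by simp
    then show "x = 0\<^sub>v n" using neg[OF x] by blast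
  qed blast
  obtain c where c: "c > 0" "\<And>x. x \<in> carrier_vec n \<Longrightarrow> \<bar>x \<bullet> (Y *\<^sub>v x)\<bar> \<le> c * (x \<bullet> x)"
    using quadratic_form_bound[OF Y(1)] by blast
  show ?thesis
  proof
    show "1 / c > 0" using c by simp
    fix x :: "real vec" assume x: "x \<in> carrier_vec n"
    \<comment> \<open>The choice \<open>t = 1 / c\<close> minimises
      \<open>c * t\<^sup>2 - 2 * t\<close>, the factor of \<open>x \<bullet> x\<close> in the
      resulting upper bound; the minimum is \<open>- 1 / c\<close>.\<close>
    define t y where "t = 1 / c" and "y = Y *\<^sub>v x"
    have y: "y \<in> carrier_vec n" using Y x by (simp add: y_def)
    have Xy: "X *\<^sub>v y = x"
      using assoc_mult_mat_vec[OF X Y(1) x] Y(2) x by (simp add: y_def)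
    \<comment> \<open>Symmetry of \<open>X\<close> moves it onto \<open>y\<close>, where it cancels
      \<open>Y\<close>.\<close>
    have yX: "y \<bullet> (X *\<^sub>v x) = x \<bullet> x"
      using transpose_scalar_prod_dim[of X y x] sym X x y Xy by simp
    have "(x + t \<cdot>\<^sub>v y) \<bullet> (X *\<^sub>v (x + t \<cdot>\<^sub>v y)) \<le> 0"
      using x y by (intro nonpos) auto
    also have "(x + t \<cdot>\<^sub>v y) \<bullet> (X *\<^sub>v (x + t \<cdot>\<^sub>v y))
        = x \<bullet> (X *\<^sub>v x) + 2 * t * (x \<bullet> x) + t\<^sup>2 * (x \<bullet> y)"
      using X x y by (simp add: mat_vec_expand mult_mat_vec[OF X y] Xy yX algebra_simps
          power2_eq_square comm_scalar_prod[OF y x])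
    finally have le: "x \<bullet> (X *\<^sub>v x) + 2 * t * (x \<bullet> x) + t\<^sup>2 * (x \<bullet> y) \<le> 0" .
    have "- (t\<^sup>2 * (x \<bullet> y)) \<le> t\<^sup>2 * (c * (x \<bullet> x))"
      using mult_left_mono[of "- (x \<bullet> y)" "c * (x \<bullet> x)" "t\<^sup>2"] c(2)[OF x] by (simp add: y_def)
    also have "t\<^sup>2 * (c * (x \<bullet> x)) = t * (x \<bullet> x)"
      using c(1) by (simp add: t_def power2_eq_square)
    finally have "x \<bullet> (X *\<^sub>v x) \<le> - t * (x \<bullet> x)" using le by simp
    then show "x \<bullet> (X *\<^sub>v x) \<le> - (1 / c) * (x \<bullet> x)"
      by (simp add: t_def)
  qed
qed

section \<open>The multiplier as a quadratic form\<close>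

text \<open>The four signed copies of \<open>M1\<close> assemble into its form at
  \<open>W - V\<close>, \<open>M2\<close> acts on \<open>W\<close> alone, and \<open>M3\<close> and
  its transpose contribute equally, whence the factor 2.\<close>

lemma multiplier_quadratic_form:
  fixes M1 M2 M3 :: "real mat"
  assumes M: "M1 \<in> carrier_mat n n" "M2 \<in> carrier_mat n n" "M3 \<in> carrier_mat n n"
    and V: "V \<in> carrier_vec n" and W: "W \<in> carrier_vec n"
  shows "(V @\<^sub>v W) \<bullet> (four_block_mat M1 (- M3\<^sup>T - M1) (- M3 - M1) (M1 + M2 + M3 + M3\<^sup>T) *\<^sub>v (V @\<^sub>v W))
    = (W - V) \<bullet> (M1 *\<^sub>v (W - V)) + W \<bullet> (M2 *\<^sub>v W) + 2 * (W \<bullet> (M3 *\<^sub>v (W - V)))"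
proof -
  have *: "four_block_mat M1 (- M3\<^sup>T - M1) (- M3 - M1) (M1 + M2 + M3 + M3\<^sup>T) *\<^sub>v (V @\<^sub>v W)
    = (M1 *\<^sub>v V + (- M3\<^sup>T - M1) *\<^sub>v W) @\<^sub>v ((- M3 - M1) *\<^sub>v V + (M1 + M2 + M3 + M3\<^sup>T) *\<^sub>v W)"
    by (rule four_block_mat_mult_vec) (use M V W in auto)
  have comm: "(M3 *\<^sub>v V) \<bullet> W = W \<bullet> (M3 *\<^sub>v V)" "(M3 *\<^sub>v W) \<bullet> W = W \<bullet> (M3 *\<^sub>v W)"
    using M V W by (auto intro!: comm_scalar_prod[of _ n])
  show ?thesis
    unfolding * using M V W by (simp add: mat_vec_expand comm)
qed

lemma arrow_mat_carrier [simp]: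
  "arrow_mat m N R C \<in> carrier_mat ((N + 1) * m) ((N + 1) * m)"
  by (simp add: arrow_mat_def)

text \<open>A stacked index encodes a pair: the quotient by \<open>m\<close> is the lag, the
  remainder the channel.\<close>

lemma div_mod_stack_index:
  fixes i m N :: nat
  assumes "i < (N + 1) * m"
  shows "i div m \<le> N" "i mod m < m"
proof -
  have "m > 0" using assms by (cases m) auto
  then show "i mod m < m" by simp
  show "i div m \<le> N" using assms by (metis Suc_eq_plus1 less_Suc_eq_le less_mult_imp_div_less)
qed

lemma arrow_mat_nonneg:
  assumes "\<And>i. i \<le> N \<Longrightarrow> nonneg_square_mat m (Q i)"
    and "i < (N + 1) * m" "j < (N + 1) * m"
  shows "0 \<le> arrow_mat m N Q Q $$ (i, j)"
  using assms div_mod_stack_index[OF assms(2)] div_mod_stack_index[OF assms(3)]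
  by (auto simp: arrow_mat_def nonneg_square_mat_def)

text \<open>Entries without a prescribed sign occur only on the diagonal of the block
  \<open>Q 0\<close>, and this block sits at the top left, so they lie on the diagonal of the whole
  matrix.\<close>

lemma arrow_mat_Metzler:
  fixes Q :: "int \<Rightarrow> real mat"
  assumes "\<And>i. - int N \<le> i \<Longrightarrow> i \<le> int N \<Longrightarrow> i \<noteq> 0 \<Longrightarrow> nonneg_square_mat m (Q i)"
    and "Metzler_mat m (Q 0)"
    and "i < (N + 1) * m" "j < (N + 1) * m" "i \<noteq> j"
  shows "0 \<le> arrow_mat m N (\<lambda>i. Q (int i)) (\<lambda>i. Q (- int i)) $$ (i, j)"
proof -
  note ij = div_mod_stack_index[OF assms(3)] div_mod_stack_index[OF assms(4)]
  consider "i div m = 0" "j div m = 0" | "i div m = 0" "j div m \<noteq> 0"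
    | "i div m \<noteq> 0" "j div m = 0" | "i div m \<noteq> 0" "j div m \<noteq> 0" by blast
  then show ?thesis
  proof cases
    case 1
    \<comment> \<open>Both indices lie in block 0, so being distinct they differ in the
      remainder.\<close>
    then have "i mod m \<noteq> j mod m"
      using assms(5) by (metis div_mod_decomp)
    then show ?thesis using assms(2-4) ij 1 by (auto simp: arrow_mat_def Metzler_mat_def)
  next
    case 2
    then show ?thesis using assms(1)[of "int (j div m)"] assms(3,4) ij
      by (auto simp: arrow_mat_def nonneg_square_mat_def)
  next
    case 3
    then show ?thesis using assms(1)[of "- int (i div m)"] assms(3,4) ij
      by (auto simp: arrow_mat_def nonneg_square_mat_def)
  next
    case 4
    then show ?thesis using assms(3,4) by (auto simp: arrow_mat_def)
  qed
qed

text \<open>The form is non-negative at every single instant, since the sign and complementarity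
  relations hold for each lagged entry separately.\<close>

lemma multiplier_relu_nonneg:
  assumes Q1: "\<And>i. i \<le> N \<Longrightarrow> nonneg_square_mat m (Q1 i)"
    and Q2: "\<And>i. i \<le> N \<Longrightarrow> nonneg_square_mat m (Q2 i)"
    and Q3: "\<And>i. - int N \<le> i \<Longrightarrow> i \<le> int N \<Longrightarrow> i \<noteq> 0 \<Longrightarrow> nonneg_square_mat m (Q3 i)"
    and Q30: "Metzler_mat m (Q3 0)"
    and v: "v \<in> l2e m" and w: "w = Delta_relu v"
  shows "0 \<le> fir_output m N v w k \<bullet> (multiplier m N Q1 Q2 Q3 *\<^sub>v fir_output m N v w k)"
proof -
  let ?n = "(N + 1) * m"
  define V W where "V = lag_stack m N v k" and "W = lag_stack m N w k"
  let ?M3 = "arrow_mat m N (\<lambda>i. Q3 (int i)) (\<lambda>i. Q3 (- int i))"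
  have VW: "V \<in> carrier_vec ?n" "W \<in> carrier_vec ?n" "W - V \<in> carrier_vec ?n"
    unfolding V_def W_def by (auto simp: lag_stack_def)
  have vd: "\<And>l. dim_vec (v l) = m" using v by (auto simp: l2e_def)
  \<comment> \<open>With \<open>s\<close> the lagged entry of \<open>v\<close>, the entries here are
    \<open>relu s\<close> and \<open>relu s - s\<close>, the positive and negative parts of
    \<open>s\<close>; lags reaching before time zero give 0 in both.\<close>
  have W: "0 \<le> W $ i" and Z: "0 \<le> (W - V) $ i" and WZ: "W $ i * (W - V) $ i = 0"
    if "i < ?n" for i
    using that div_mod_stack_index[OF that]
    by (auto simp: V_def W_def lag_stack_def w Delta_relu_def relu_vec_def vd relu_def)
  have "0 \<le> (W - V) \<bullet> (arrow_mat m N Q1 Q1 *\<^sub>v (W - V))"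
    by (rule bilinear_form_nonneg[OF arrow_mat_carrier VW(3) VW(3)])
      (intro mult_nonneg_nonneg Z arrow_mat_nonneg Q1)
  moreover have "0 \<le> W \<bullet> (arrow_mat m N Q2 Q2 *\<^sub>v W)"
    by (rule bilinear_form_nonneg[OF arrow_mat_carrier VW(2) VW(2)])
      (intro mult_nonneg_nonneg W arrow_mat_nonneg Q2)
  moreover have "0 \<le> W \<bullet> (?M3 *\<^sub>v (W - V))"
  proof (rule bilinear_form_nonneg[OF arrow_mat_carrier VW(2) VW(3)])
    fix i j assume ij: "i < ?n" "j < ?n"
    show "0 \<le> W $ i * ?M3 $$ (i, j) * (W - V) $ j"
    proof (cases "i = j")
      case True
      \<comment> \<open>The diagonal entry may be negative, but the product of signals that
        multiplies it is zero.\<close>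
      have "W $ i * ?M3 $$ (i, j) * (W - V) $ j = ?M3 $$ (i, j) * (W $ i * (W - V) $ i)"
        unfolding True by (simp only: mult_ac)
      also have "\<dots> = 0" unfolding WZ[OF ij(1)] by simp
      finally show ?thesis by (rule eq_refl[OF sym])
    next
      case False
      then show ?thesis
        by (intro mult_nonneg_nonneg W Z ij arrow_mat_Metzler Q3 Q30)
    qed
  qed
  ultimately show ?thesis
    unfolding fir_output_def multiplier_def Let_def V_def[symmetric] W_def[symmetric]
      multiplier_quadratic_form[OF arrow_mat_carrier arrow_mat_carrier arrow_mat_carrier VW(1,2)]
    by simp
qed

section \<open>Block matrices and the form of the LMI\<close>

lemma append_cols_carrier [simp, intro]:
  assumes "X \<in> carrier_mat n k" "Y \<in> carrier_mat n l"
  shows "append_cols X Y \<in> carrier_mat n (k + l)"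
proof -
  have "append_cols X Y \<in> carrier_mat (n + 0) (k + l)"
    unfolding append_cols_def using assms by (intro four_block_carrier_mat) auto
  then show ?thesis by simp
qed

lemma append_cols_mult_vec:
  fixes X Y :: "real mat"
  assumes X: "X \<in> carrier_mat n k" and Y: "Y \<in> carrier_mat n l"
    and a: "a \<in> carrier_vec k" and b: "b \<in> carrier_vec l"
  shows "append_cols X Y *\<^sub>v (a @\<^sub>v b) = X *\<^sub>v a + Y *\<^sub>v b"
proof -
  \<comment> \<open>The lower block row has height 0, so the appended second vector is empty and
    only the first survives.\<close>
  have "append_cols X Y *\<^sub>v (a @\<^sub>v b)
      = (X *\<^sub>v a + Y *\<^sub>v b) @\<^sub>v (0\<^sub>m 0 k *\<^sub>v a + 0\<^sub>m 0 l *\<^sub>v b)"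
    unfolding append_cols_def carrier_matD(2)[OF X] carrier_matD(2)[OF Y]
    using X Y a b by (intro four_block_mat_mult_vec) auto
  then show ?thesis using X Y a b by (auto intro!: eq_vecI)
qed

text \<open>The output matrices enter the LMI as stacked transposes; transposing the stack again
  makes it act on a stacked vector as a sum of output terms.\<close>

lemma transpose_append_rows_mult_vec:
  fixes X Y :: "real mat"
  assumes X: "X \<in> carrier_mat k n" and Y: "Y \<in> carrier_mat l n"
    and a: "a \<in> carrier_vec k" and b: "b \<in> carrier_vec l"
  shows "(X @\<^sub>r Y)\<^sup>T *\<^sub>v (a @\<^sub>v b) = X\<^sup>T *\<^sub>v a + Y\<^sup>T *\<^sub>v b"
proof -
  have "(X @\<^sub>r Y)\<^sup>T = append_cols (X\<^sup>T) (Y\<^sup>T)"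
    using X Y unfolding append_rows_def append_cols_def
    by (subst transpose_four_block_mat) auto
  then show ?thesis using append_cols_mult_vec[of "X\<^sup>T" n k "Y\<^sup>T" l a b] assms by simp
qed

text \<open>The outer factor passes to the left vector. Both added terms of the LMI have this shape,
  the performance term with the identity as \<open>M\<close>.\<close>

lemma gram_form:
  fixes E M :: "real mat"
  assumes E: "E \<in> carrier_mat n k" and M: "M \<in> carrier_mat k k" and z: "z \<in> carrier_vec n"
  shows "z \<bullet> ((E * M * E\<^sup>T) *\<^sub>v z) = (E\<^sup>T *\<^sub>v z) \<bullet> (M *\<^sub>v (E\<^sup>T *\<^sub>v z))"
proof -
  have "z \<bullet> ((E * M * E\<^sup>T) *\<^sub>v z) = z \<bullet> ((E\<^sup>T)\<^sup>T *\<^sub>v (M *\<^sub>v (E\<^sup>T *\<^sub>v z)))"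
    using E M z by (simp add: mult_mat_mult_vec_dim)
  also have "\<dots> = (E\<^sup>T *\<^sub>v z) \<bullet> (M *\<^sub>v (E\<^sup>T *\<^sub>v z))"
    by (rule transpose_scalar_prod_dim) (use E M z in auto)
  finally show ?thesis .
qed

lemma block_mat3_form:
  fixes X11 :: "real mat"
  assumes "X11 \<in> carrier_mat n n" "X12 \<in> carrier_mat n k" "X13 \<in> carrier_mat n l"
    and "X21 \<in> carrier_mat k n" "X22 \<in> carrier_mat k k" "X23 \<in> carrier_mat k l"
    and "X31 \<in> carrier_mat l n" "X32 \<in> carrier_mat l k" "X33 \<in> carrier_mat l l"
    and "a \<in> carrier_vec n" "b \<in> carrier_vec k" "c \<in> carrier_vec l"
  shows "(a @\<^sub>v b @\<^sub>v c) \<bullet> (block_mat3 X11 X12 X13 X21 X22 X23 X31 X32 X33 *\<^sub>v (a @\<^sub>v b @\<^sub>v c))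
    = a \<bullet> (X11 *\<^sub>v a) + a \<bullet> (X12 *\<^sub>v b) + a \<bullet> (X13 *\<^sub>v c)
    + b \<bullet> (X21 *\<^sub>v a) + b \<bullet> (X22 *\<^sub>v b) + b \<bullet> (X23 *\<^sub>v c)
    + c \<bullet> (X31 *\<^sub>v a) + c \<bullet> (X32 *\<^sub>v b) + c \<bullet> (X33 *\<^sub>v c)"
proof -
  have bc: "b @\<^sub>v c \<in> carrier_vec (k + l)" using assms by auto
  have "block_mat3 X11 X12 X13 X21 X22 X23 X31 X32 X33 *\<^sub>v (a @\<^sub>v b @\<^sub>v c)
    = (X11 *\<^sub>v a + append_cols X12 X13 *\<^sub>v (b @\<^sub>v c)) @\<^sub>v
      ((X21 @\<^sub>r X31) *\<^sub>v a + four_block_mat X22 X23 X32 X33 *\<^sub>v (b @\<^sub>v c))"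
    unfolding block_mat3_def
  proof (rule four_block_mat_mult_vec[OF assms(1) _ _ _ assms(10) bc])
    show "append_cols X12 X13 \<in> carrier_mat n (k + l)" using assms by simp
    show "X21 @\<^sub>r X31 \<in> carrier_mat (k + l) n" using assms by simp
    show "four_block_mat X22 X23 X32 X33 \<in> carrier_mat (k + l) (k + l)" using assms by simp
  qed
  also have "append_cols X12 X13 *\<^sub>v (b @\<^sub>v c) = X12 *\<^sub>v b + X13 *\<^sub>v c"
    using assms by (intro append_cols_mult_vec)
  also have "(X21 @\<^sub>r X31) *\<^sub>v a = X21 *\<^sub>v a @\<^sub>v X31 *\<^sub>v a"
    using assms by (intro mat_mult_append)
  also have "four_block_mat X22 X23 X32 X33 *\<^sub>v (b @\<^sub>v c)
      = (X22 *\<^sub>v b + X23 *\<^sub>v c) @\<^sub>v (X32 *\<^sub>v b + X33 *\<^sub>v c)"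
    using assms by (intro four_block_mat_mult_vec)
  finally show ?thesis
    using assms by (simp add: mat_vec_expand)
qed

text \<open>The nine blocks are the products obtained by expanding
  \<open>y \<bullet> (P *\<^sub>v y)\<close>; the two corrected diagonal blocks account for the
  stored energy and the disturbance energy that are subtracted.\<close>

lemma lmi_block_form:
  fixes A :: "real mat"
  assumes A: "A \<in> carrier_mat n n" and B1: "B1 \<in> carrier_mat n k" and B2: "B2 \<in> carrier_mat n l"
    and P: "P \<in> carrier_mat n n"
    and a: "a \<in> carrier_vec n" and b: "b \<in> carrier_vec k" and c: "c \<in> carrier_vec l"
  defines "y \<equiv> A *\<^sub>v a + B1 *\<^sub>v b + B2 *\<^sub>v c"
  shows "(a @\<^sub>v b @\<^sub>v c) \<bullet> (block_mat3
      (A\<^sup>T * P * A - P)  (A\<^sup>T * P * B1)   (A\<^sup>T * P * B2)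
      (B1\<^sup>T * P * A)     (B1\<^sup>T * P * B1)  (B1\<^sup>T * P * B2)
      (B2\<^sup>T * P * A)     (B2\<^sup>T * P * B1)  (B2\<^sup>T * P * B2 - g \<cdot>\<^sub>m 1\<^sub>m l) *\<^sub>v (a @\<^sub>v b @\<^sub>v c))
    = y \<bullet> (P *\<^sub>v y) - a \<bullet> (P *\<^sub>v a) - g * (c \<bullet> c)"
proof -
  have term1: "u \<bullet> ((X\<^sup>T * P * Y) *\<^sub>v v) = (X *\<^sub>v u) \<bullet> (P *\<^sub>v (Y *\<^sub>v v))"
    if "X \<in> carrier_mat n i" "Y \<in> carrier_mat n j" "u \<in> carrier_vec i" "v \<in> carrier_vec j"
    for X Y u v i j
    using that P by (simp add: mat_vec_expand)
  have y: "y \<bullet> (P *\<^sub>v y) =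
      (A *\<^sub>v a) \<bullet> (P *\<^sub>v (A *\<^sub>v a)) + (A *\<^sub>v a) \<bullet> (P *\<^sub>v (B1 *\<^sub>v b)) + (A *\<^sub>v a) \<bullet> (P *\<^sub>v (B2 *\<^sub>v c))
    + (B1 *\<^sub>v b) \<bullet> (P *\<^sub>v (A *\<^sub>v a)) + (B1 *\<^sub>v b) \<bullet> (P *\<^sub>v (B1 *\<^sub>v b)) + (B1 *\<^sub>v b) \<bullet> (P *\<^sub>v (B2 *\<^sub>v c))
    + (B2 *\<^sub>v c) \<bullet> (P *\<^sub>v (A *\<^sub>v a)) + (B2 *\<^sub>v c) \<bullet> (P *\<^sub>v (B1 *\<^sub>v b)) + (B2 *\<^sub>v c) \<bullet> (P *\<^sub>v (B2 *\<^sub>v c))"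
    unfolding y_def using A B1 B2 P a b c by (simp add: mat_vec_expand)
  have d1: "a \<bullet> ((A\<^sup>T * P * A - P) *\<^sub>v a) = a \<bullet> ((A\<^sup>T * P * A) *\<^sub>v a) - a \<bullet> (P *\<^sub>v a)"
    using A P a by (simp add: diff_mat_mult_vec_dim scalar_prod_diff_right_dim)
  have d2: "c \<bullet> ((B2\<^sup>T * P * B2 - g \<cdot>\<^sub>m 1\<^sub>m l) *\<^sub>v c) = c \<bullet> ((B2\<^sup>T * P * B2) *\<^sub>v c) - g * (c \<bullet> c)"
    using B2 P c by (simp add: diff_mat_mult_vec_dim scalar_prod_diff_right_dim smult_mat_mult_vec_dim)
  show ?thesis
    by (subst block_mat3_form[OF _ _ _ _ _ _ _ _ _ a b c])
      (use A B1 B2 P a b c in \<open>auto simp only: d1 d2 y term1 intro!: minus_carrier_mat mult_carrier_mat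
        transpose_carrier_mat[THEN iffD2] smult_carrier_mat one_carrier_mat\<close>)
qed

text \<open>This turns the matrix inequality into an energy balance: on the right stand the storage
  after and before one step, the disturbance energy, the output energy and the multiplier form of
  the filter output.\<close>

lemma lmi_mat_form:
  assumes A: "hat_A G F \<in> carrier_mat n n" and B1: "hat_B1 G F \<in> carrier_mat n k"
    and B2: "hat_B2 G F \<in> carrier_mat n l"
    and C1: "hat_C1 G F \<in> carrier_mat q n" and D11: "hat_D11 G F \<in> carrier_mat q k"
    and D12: "hat_D12 G F \<in> carrier_mat q l"
    and C2: "hat_C2 G F \<in> carrier_mat p n" and D21: "hat_D21 G F \<in> carrier_mat p k"
    and D22: "hat_D22 G F \<in> carrier_mat p l"
    and P: "P \<in> carrier_mat n n" and M: "M \<in> carrier_mat q q"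
    and a: "a \<in> carrier_vec n" and b: "b \<in> carrier_vec k" and c: "c \<in> carrier_vec l"
  defines "y \<equiv> hat_A G F *\<^sub>v a + hat_B1 G F *\<^sub>v b + hat_B2 G F *\<^sub>v c"
    and "r \<equiv> hat_C1 G F *\<^sub>v a + hat_D11 G F *\<^sub>v b + hat_D12 G F *\<^sub>v c"
    and "e \<equiv> hat_C2 G F *\<^sub>v a + hat_D21 G F *\<^sub>v b + hat_D22 G F *\<^sub>v c"
  shows "(a @\<^sub>v b @\<^sub>v c) \<bullet> (lmi_mat G F P M g *\<^sub>v (a @\<^sub>v b @\<^sub>v c))
    = y \<bullet> (P *\<^sub>v y) - a \<bullet> (P *\<^sub>v a) - g * (c \<bullet> c) + e \<bullet> e + r \<bullet> (M *\<^sub>v r)"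
proof -
  let ?A = "hat_A G F" and ?B1 = "hat_B1 G F" and ?B2 = "hat_B2 G F"
  let ?z = "a @\<^sub>v b @\<^sub>v c"
  let ?N = "n + (k + l)"
  define E where "E = (hat_C2 G F)\<^sup>T @\<^sub>r (hat_D21 G F)\<^sup>T @\<^sub>r (hat_D22 G F)\<^sup>T"
  define R where "R = (hat_C1 G F)\<^sup>T @\<^sub>r (hat_D11 G F)\<^sup>T @\<^sub>r (hat_D12 G F)\<^sup>T"
  define K where "K = block_mat3
      (?A\<^sup>T * P * ?A - P)  (?A\<^sup>T * P * ?B1)   (?A\<^sup>T * P * ?B2)
      (?B1\<^sup>T * P * ?A)     (?B1\<^sup>T * P * ?B1)  (?B1\<^sup>T * P * ?B2)
      (?B2\<^sup>T * P * ?A)     (?B2\<^sup>T * P * ?B1)  (?B2\<^sup>T * P * ?B2 - g \<cdot>\<^sub>m 1\<^sub>m l)"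
  have z: "?z \<in> carrier_vec ?N" using a b c by simp
  have stacked: "(X\<^sup>T @\<^sub>r Y\<^sup>T @\<^sub>r Z\<^sup>T) \<in> carrier_mat ?N i"
      "(X\<^sup>T @\<^sub>r Y\<^sup>T @\<^sub>r Z\<^sup>T)\<^sup>T *\<^sub>v ?z = X *\<^sub>v a + Y *\<^sub>v b + Z *\<^sub>v c"
    if X: "X \<in> carrier_mat i n" and Y: "Y \<in> carrier_mat i k" and Z: "Z \<in> carrier_mat i l"
    for X Y Z :: "real mat" and i
  proof -
    have T: "X\<^sup>T \<in> carrier_mat n i" "Y\<^sup>T \<in> carrier_mat k i" "Z\<^sup>T \<in> carrier_mat l i"
      using X Y Z by auto
    have YZ: "Y\<^sup>T @\<^sub>r Z\<^sup>T \<in> carrier_mat (k + l) i" using T by simp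
    show "(X\<^sup>T @\<^sub>r Y\<^sup>T @\<^sub>r Z\<^sup>T) \<in> carrier_mat ?N i" using T YZ by simp
    have bc: "b @\<^sub>v c \<in> carrier_vec (k + l)" using b c by simp
    show "(X\<^sup>T @\<^sub>r Y\<^sup>T @\<^sub>r Z\<^sup>T)\<^sup>T *\<^sub>v ?z = X *\<^sub>v a + Y *\<^sub>v b + Z *\<^sub>v c"
      unfolding transpose_append_rows_mult_vec[OF T(1) YZ a bc]
        transpose_append_rows_mult_vec[OF T(2,3) b c] transpose_transpose
      using X Y Z a b c by (intro assoc_add_vec[symmetric, of _ i]) auto
  qed
  note E = stacked[OF C2 D21 D22, folded E_def e_def]
  note R = stacked[OF C1 D11 D12, folded R_def r_def]
  have K: "K \<in> carrier_mat ?N ?N"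
  proof -
    have c12: "append_cols (?A\<^sup>T * P * ?B1) (?A\<^sup>T * P * ?B2) \<in> carrier_mat n (k + l)"
      using A B1 B2 P by (intro append_cols_carrier) auto
    have c21: "?A\<^sup>T * P * ?A - P \<in> carrier_mat n n" by (rule minus_carrier_mat[OF P])
    have c22: "four_block_mat (?B1\<^sup>T * P * ?B1) (?B1\<^sup>T * P * ?B2) (?B2\<^sup>T * P * ?B1)
        (?B2\<^sup>T * P * ?B2 - g \<cdot>\<^sub>m 1\<^sub>m l) \<in> carrier_mat (k + l) (k + l)"
      using B1 B2 P by (intro four_block_carrier_mat) auto
    show ?thesis unfolding K_def block_mat3_def by (rule four_block_carrier_mat[OF c21 c22])
  qed
  have EE: "E * E\<^sup>T \<in> carrier_mat ?N ?N" using E(1) by simp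
  have RMR: "R * M * R\<^sup>T \<in> carrier_mat ?N ?N" using R(1) M by auto
  have "lmi_mat G F P M g = K + E * E\<^sup>T + R * M * R\<^sup>T"
    using B2 by (simp add: lmi_mat_def Let_def K_def E_def R_def)
  then have "?z \<bullet> (lmi_mat G F P M g *\<^sub>v ?z)
      = ?z \<bullet> (K *\<^sub>v ?z) + ?z \<bullet> ((E * E\<^sup>T) *\<^sub>v ?z) + ?z \<bullet> ((R * M * R\<^sup>T) *\<^sub>v ?z)"
    using K EE RMR z
    by (simp add: add_mult_distrib_mat_vec[of _ ?N ?N] scalar_prod_add_distrib[of _ ?N])
  moreover have "?z \<bullet> (K *\<^sub>v ?z) = y \<bullet> (P *\<^sub>v y) - a \<bullet> (P *\<^sub>v a) - g * (c \<bullet> c)"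
    unfolding K_def y_def by (rule lmi_block_form[OF A B1 B2 P a b c])
  moreover have "?z \<bullet> ((E * E\<^sup>T) *\<^sub>v ?z) = e \<bullet> e"
  proof -
    have "hat_D22 G F *\<^sub>v c \<in> carrier_vec p" by (rule mult_mat_vec_carrier[OF D22 c])
    then have ec: "e \<in> carrier_vec p"
      unfolding e_def by (rule add_carrier_vec[OF add_carrier_vec[OF mult_mat_vec_carrier[OF C2 a] mult_mat_vec_carrier[OF D21 b]]])
    \<comment> \<open>An identity inserted between \<open>E\<close> and its transpose brings the
      term into the shape of \<open>gram_form\<close>.\<close>
    have "?z \<bullet> ((E * 1\<^sub>m p * E\<^sup>T) *\<^sub>v ?z) = e \<bullet> (1\<^sub>m p *\<^sub>v e)"
      unfolding gram_form[OF E(1) one_carrier_mat z] E(2) ..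
    then show ?thesis
      unfolding right_mult_one_mat[OF E(1)] one_mult_mat_vec[OF ec] .
  qed
  moreover have "?z \<bullet> ((R * M * R\<^sup>T) *\<^sub>v ?z) = r \<bullet> (M *\<^sub>v r)"
    unfolding gram_form[OF R(1) M z] R(2) ..
  ultimately show ?thesis by (simp only:)
qed

section \<open>The augmented system of plant and filter\<close>

context
  fixes nx m nd ne np nr :: nat and G :: lti and F :: filter_ss
  assumes G: "lti_dims nx m nd ne G" and F: "filter_dims np m nr F"
begin

lemma hat_carrier:
  shows "hat_A G F \<in> carrier_mat (nx + np) (nx + np)"
    and "hat_B1 G F \<in> carrier_mat (nx + np) m"
    and "hat_B2 G F \<in> carrier_mat (nx + np) nd"
    and "hat_C1 G F \<in> carrier_mat nr (nx + np)"
    and "hat_D11 G F \<in> carrier_mat nr m"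
    and "hat_D12 G F \<in> carrier_mat nr nd"
    and "hat_C2 G F \<in> carrier_mat ne (nx + np)"
    and "hat_D21 G F \<in> carrier_mat ne m"
    and "hat_D22 G F \<in> carrier_mat ne nd"
  using G F
  by (auto simp: lti_dims_def filter_dims_def hat_A_def hat_B1_def hat_B2_def hat_C1_def
      hat_C2_def hat_D11_def hat_D12_def hat_D21_def hat_D22_def
      intro!: four_block_carrier_mat append_cols_carrier carrier_append_rows)

text \<open>Eliminating the filter input \<open>v\<close> by the plant output equation produces the
  products in the augmented matrices, so one augmented step is a plant step stacked on a filter
  step.\<close>

lemma augmented_system:
  assumes carr: "x \<in> carrier_vec nx" "\<psi> \<in> carrier_vec np" "w \<in> carrier_vec m" "d \<in> carrier_vec nd"
  defines "v \<equiv> sys_C1 G *\<^sub>v x + sys_D11 G *\<^sub>v w + sys_D12 G *\<^sub>v d"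
  shows "hat_A G F *\<^sub>v (x @\<^sub>v \<psi>) + hat_B1 G F *\<^sub>v w + hat_B2 G F *\<^sub>v d
      = (sys_A G *\<^sub>v x + sys_B1 G *\<^sub>v w + sys_B2 G *\<^sub>v d) @\<^sub>v
        (flt_A F *\<^sub>v \<psi> + flt_B1 F *\<^sub>v v + flt_B2 F *\<^sub>v w)"
    and "hat_C1 G F *\<^sub>v (x @\<^sub>v \<psi>) + hat_D11 G F *\<^sub>v w + hat_D12 G F *\<^sub>v d
      = flt_C F *\<^sub>v \<psi> + flt_D1 F *\<^sub>v v + flt_D2 F *\<^sub>v w"
    and "hat_C2 G F *\<^sub>v (x @\<^sub>v \<psi>) + hat_D21 G F *\<^sub>v w + hat_D22 G F *\<^sub>v d
      = sys_C2 G *\<^sub>v x + sys_D21 G *\<^sub>v w + sys_D22 G *\<^sub>v d"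
proof -
  have g: "sys_A G \<in> carrier_mat nx nx" "sys_B1 G \<in> carrier_mat nx m" "sys_B2 G \<in> carrier_mat nx nd"
    "sys_C1 G \<in> carrier_mat m nx" "sys_D11 G \<in> carrier_mat m m" "sys_D12 G \<in> carrier_mat m nd"
    "sys_C2 G \<in> carrier_mat ne nx" "sys_D21 G \<in> carrier_mat ne m" "sys_D22 G \<in> carrier_mat ne nd"
    using G by (auto simp: lti_dims_def)
  have f: "flt_A F \<in> carrier_mat np np" "flt_B1 F \<in> carrier_mat np m" "flt_B2 F \<in> carrier_mat np m"
    "flt_C F \<in> carrier_mat nr np" "flt_D1 F \<in> carrier_mat nr m" "flt_D2 F \<in> carrier_mat nr m"
    using F by (auto simp: filter_dims_def)
  note dims = carrier_matD[OF g(1)] carrier_matD[OF g(2)] carrier_matD[OF g(3)] carrier_matD[OF g(4)]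
    carrier_matD[OF g(5)] carrier_matD[OF g(6)] carrier_matD[OF g(7)] carrier_matD[OF g(8)]
    carrier_matD[OF g(9)] carrier_matD[OF f(1)] carrier_matD[OF f(2)] carrier_matD[OF f(3)]
    carrier_matD[OF f(4)] carrier_matD[OF f(5)] carrier_matD[OF f(6)]
    carrier_vecD[OF carr(1)] carrier_vecD[OF carr(2)] carrier_vecD[OF carr(3)] carrier_vecD[OF carr(4)]
  have zero: "0\<^sub>m i np *\<^sub>v \<psi> = 0\<^sub>v i" for i
    using carr(2) by (intro eq_vecI) auto
  have "hat_A G F *\<^sub>v (x @\<^sub>v \<psi>)
      = (sys_A G *\<^sub>v x + 0\<^sub>m nx np *\<^sub>v \<psi>) @\<^sub>v ((flt_B1 F * sys_C1 G) *\<^sub>v x + flt_A F *\<^sub>v \<psi>)"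
    unfolding hat_A_def dims by (rule four_block_mat_mult_vec) (use g f carr in auto)
  moreover have "hat_B1 G F *\<^sub>v w
      = sys_B1 G *\<^sub>v w @\<^sub>v (flt_B1 F * sys_D11 G + flt_B2 F) *\<^sub>v w"
    unfolding hat_B1_def by (rule mat_mult_append) (use g f carr in auto)
  moreover have "hat_B2 G F *\<^sub>v d = sys_B2 G *\<^sub>v d @\<^sub>v (flt_B1 F * sys_D12 G) *\<^sub>v d"
    unfolding hat_B2_def by (rule mat_mult_append) (use g f carr in auto)
  ultimately show "hat_A G F *\<^sub>v (x @\<^sub>v \<psi>) + hat_B1 G F *\<^sub>v w + hat_B2 G F *\<^sub>v d
      = (sys_A G *\<^sub>v x + sys_B1 G *\<^sub>v w + sys_B2 G *\<^sub>v d) @\<^sub>v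
        (flt_A F *\<^sub>v \<psi> + flt_B1 F *\<^sub>v v + flt_B2 F *\<^sub>v w)"
    by (intro eq_vecI) (simp_all add: v_def dims zero mat_vec_expand)
  have "hat_C1 G F *\<^sub>v (x @\<^sub>v \<psi>) = (flt_D1 F * sys_C1 G) *\<^sub>v x + flt_C F *\<^sub>v \<psi>"
    unfolding hat_C1_def by (rule append_cols_mult_vec) (use g f carr in auto)
  then show "hat_C1 G F *\<^sub>v (x @\<^sub>v \<psi>) + hat_D11 G F *\<^sub>v w + hat_D12 G F *\<^sub>v d
      = flt_C F *\<^sub>v \<psi> + flt_D1 F *\<^sub>v v + flt_D2 F *\<^sub>v w"
    by (intro eq_vecI) (simp_all add: v_def hat_D11_def hat_D12_def dims mat_vec_expand)
  have "hat_C2 G F *\<^sub>v (x @\<^sub>v \<psi>) = sys_C2 G *\<^sub>v x + 0\<^sub>m ne np *\<^sub>v \<psi>"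
    unfolding hat_C2_def dims by (rule append_cols_mult_vec) (use g f carr in auto)
  then show "hat_C2 G F *\<^sub>v (x @\<^sub>v \<psi>) + hat_D21 G F *\<^sub>v w + hat_D22 G F *\<^sub>v d
      = sys_C2 G *\<^sub>v x + sys_D21 G *\<^sub>v w + sys_D22 G *\<^sub>v d"
    by (intro eq_vecI) (simp_all add: hat_D21_def hat_D22_def dims zero)
qed

section \<open>Dissipation along trajectories\<close>

text \<open>The margin \<epsilon> on the whole vector is kept in two places only: the share of
  \<open>x\<close> will give stability, the share of \<open>d\<close> a gain strictly below the
  bound.\<close>

lemma lmi_dissipation:
  assumes P: "P \<in> carrier_mat (nx + np) (nx + np)" and M: "M \<in> carrier_mat nr nr"
    and lmi: "\<And>z. z \<in> carrier_vec (nx + np + m + nd) \<Longrightarrow>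
      z \<bullet> (lmi_mat G F P M g *\<^sub>v z) \<le> - \<epsilon> * (z \<bullet> z)"
    and "\<epsilon> \<ge> 0"
    and sys: "interconnection nx m nd ne G d x v w e"
    and \<psi>: "\<And>k. \<psi> k \<in> carrier_vec np"
      "\<And>k. \<psi> (Suc k) = flt_A F *\<^sub>v \<psi> k + flt_B1 F *\<^sub>v v k + flt_B2 F *\<^sub>v w k"
    and r: "r = flt_C F *\<^sub>v \<psi> k + flt_D1 F *\<^sub>v v k + flt_D2 F *\<^sub>v w k"
    and pos: "0 \<le> r \<bullet> (M *\<^sub>v r)"
  defines "V \<equiv> \<lambda>k. (x k @\<^sub>v \<psi> k) \<bullet> (P *\<^sub>v (x k @\<^sub>v \<psi> k))"
  shows "V (Suc k) + e k \<bullet> e k + \<epsilon> * (x k \<bullet> x k) \<le> V k + (g - \<epsilon>) * (d k \<bullet> d k)"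
proof -
  have c: "x k \<in> carrier_vec nx" "w k \<in> carrier_vec m" "d k \<in> carrier_vec nd"
    and eqs: "x (Suc k) = sys_A G *\<^sub>v x k + sys_B1 G *\<^sub>v w k + sys_B2 G *\<^sub>v d k"
      "v k = sys_C1 G *\<^sub>v x k + sys_D11 G *\<^sub>v w k + sys_D12 G *\<^sub>v d k"
      "e k = sys_C2 G *\<^sub>v x k + sys_D21 G *\<^sub>v w k + sys_D22 G *\<^sub>v d k"
    using sys by (auto simp: interconnection_def l2e_def)
  let ?xh = "x k @\<^sub>v \<psi> k"
  let ?z = "?xh @\<^sub>v w k @\<^sub>v d k"
  have xh: "?xh \<in> carrier_vec (nx + np)" using c \<psi>(1) by simp
  have "?z \<in> carrier_vec ((nx + np) + (m + nd))"
    by (rule append_carrier_vec[OF xh append_carrier_vec[OF c(2,3)]])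
  then have "?z \<bullet> (lmi_mat G F P M g *\<^sub>v ?z) \<le> - \<epsilon> * (?z \<bullet> ?z)"
    by (intro lmi) (simp add: add.assoc)
  moreover have "?z \<bullet> (lmi_mat G F P M g *\<^sub>v ?z)
      = V (Suc k) - V k - g * (d k \<bullet> d k) + e k \<bullet> e k + r \<bullet> (M *\<^sub>v r)"
    unfolding lmi_mat_form[OF hat_carrier P M xh c(2,3)]
      augmented_system[OF c(1) \<psi>(1) c(2,3)]
    by (simp only: V_def eqs(1)[symmetric] eqs(2)[symmetric] eqs(3)[symmetric] \<psi>(2) r)
  moreover have "?z \<bullet> ?z = x k \<bullet> x k + \<psi> k \<bullet> \<psi> k + (w k \<bullet> w k + d k \<bullet> d k)"
    by (simp add: scalar_prod_append_dim)
  \<comment> \<open>The shares of the filter state and of \<open>w\<close> in the margin are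
    non-negative and are dropped.\<close>
  moreover have "0 \<le> \<epsilon> * (\<psi> k \<bullet> \<psi> k)" "0 \<le> \<epsilon> * (w k \<bullet> w k)"
    using \<open>\<epsilon> \<ge> 0\<close> scalar_prod_self_nonneg by (auto intro: mult_nonneg_nonneg)
  ultimately show ?thesis using pos by (simp add: algebra_simps)
qed

end

text \<open>Both constants come from matrices alone, \<epsilon> from the LMI and \<open>c\<close>
  from \<open>P\<close>, hence one pair serves all trajectories and horizons. Finite horizons make
  the sums meaningful for signals not known to be square-summable.\<close>

lemma energy_bound:
  assumes G: "lti_dims nx m nd ne G" and F: "realizes_fir np m N F"
    and Q1: "\<And>i. i \<le> N \<Longrightarrow> nonneg_square_mat m (Q1 i)"
    and Q2: "\<And>i. i \<le> N \<Longrightarrow> nonneg_square_mat m (Q2 i)"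
    and Q3: "\<And>i. - int N \<le> i \<Longrightarrow> i \<le> int N \<Longrightarrow> i \<noteq> 0 \<Longrightarrow> nonneg_square_mat m (Q3 i)"
    and Q30: "Metzler_mat m (Q3 0)"
    and P: "psd_mat (nx + np) P"
    and lmi: "negdef_mat (nx + np + m + nd) (lmi_mat G F P (multiplier m N Q1 Q2 Q3) g)"
  shows "\<exists>\<epsilon>>0. \<exists>c>0. \<forall>d x v w e T. interconnection nx m nd ne G d x v w e \<longrightarrow>
      (\<Sum>k<T. e k \<bullet> e k) + \<epsilon> * (\<Sum>k<T. x k \<bullet> x k)
        \<le> c * (x 0 \<bullet> x 0) + (g - \<epsilon>) * (\<Sum>k<T. d k \<bullet> d k)"
proof -
  let ?M = "multiplier m N Q1 Q2 Q3"
  let ?nr = "2 * ((N + 1) * m)"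
  have Pc: "P \<in> carrier_mat (nx + np) (nx + np)"
    and Ppos: "\<And>z. z \<in> carrier_vec (nx + np) \<Longrightarrow> 0 \<le> z \<bullet> (P *\<^sub>v z)"
    using P by (auto simp: psd_mat_def sym_mat_def)
  have Fd: "filter_dims np m ?nr F" using F by (simp add: realizes_fir_def)
  have Fc: "flt_A F \<in> carrier_mat np np" "flt_B1 F \<in> carrier_mat np m" "flt_B2 F \<in> carrier_mat np m"
    using Fd by (auto simp: filter_dims_def)
  have M: "?M \<in> carrier_mat ?nr ?nr"
  proof -
    have "?M \<in> carrier_mat ((N + 1) * m + (N + 1) * m) ((N + 1) * m + (N + 1) * m)"
      unfolding multiplier_def Let_def
      by (intro four_block_carrier_mat add_carrier_mat arrow_mat_carrier
          transpose_carrier_mat[THEN iffD2])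
    then show ?thesis by (simp only: mult_2)
  qed
  obtain \<epsilon> where \<epsilon>: "\<epsilon> > 0" "\<And>z. z \<in> carrier_vec (nx + np + m + nd) \<Longrightarrow>
      z \<bullet> (lmi_mat G F P ?M g *\<^sub>v z) \<le> - \<epsilon> * (z \<bullet> z)"
    using negdef_mat_uniform[OF lmi] by blast
  obtain c where c: "c > 0" "\<And>z. z \<in> carrier_vec (nx + np) \<Longrightarrow> \<bar>z \<bullet> (P *\<^sub>v z)\<bar> \<le> c * (z \<bullet> z)"
    using quadratic_form_bound[OF Pc] by blast
  show ?thesis
  proof (intro exI conjI allI impI)
    show "\<epsilon> > 0" "c > 0" by fact+
    fix d x v w e T assume sys: "interconnection nx m nd ne G d x v w e"
    \<comment> \<open>The filter state is started at zero because \<open>realizes_fir\<close> fixes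
      the output only from there.\<close>
    define \<psi> where
      "\<psi> = rec_nat (0\<^sub>v np) (\<lambda>k p. flt_A F *\<^sub>v p + flt_B1 F *\<^sub>v v k + flt_B2 F *\<^sub>v w k)"
    have \<psi>: "\<psi> 0 = 0\<^sub>v np"
      "\<And>k. \<psi> (Suc k) = flt_A F *\<^sub>v \<psi> k + flt_B1 F *\<^sub>v v k + flt_B2 F *\<^sub>v w k"
      by (simp_all add: \<psi>_def)
    have vw: "v \<in> l2e m" "w \<in> l2e m" "w = Delta_relu v"
      and x: "\<And>k. x k \<in> carrier_vec nx"
      using sys by (auto simp: interconnection_def l2e_def)
    have \<psi>c: "\<psi> k \<in> carrier_vec np" for k
    proof (cases k)
      case 0
      then show ?thesis by (simp add: \<psi>(1))
    next
      case (Suc j)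
      show ?thesis
        unfolding Suc \<psi>(2) by (rule carrier_vecI) (simp add: carrier_matD(1)[OF Fc(3)])
    qed
    have fir: "fir_output m N v w k = flt_C F *\<^sub>v \<psi> k + flt_D1 F *\<^sub>v v k + flt_D2 F *\<^sub>v w k" for k
      using F vw(1,2) \<psi> by (auto simp: realizes_fir_def)
    define V where "V = (\<lambda>k. (x k @\<^sub>v \<psi> k) \<bullet> (P *\<^sub>v (x k @\<^sub>v \<psi> k)))"
    have step: "V (Suc k) + e k \<bullet> e k + \<epsilon> * (x k \<bullet> x k) \<le> V k + (g - \<epsilon>) * (d k \<bullet> d k)" for k
      unfolding V_def
      using \<epsilon>(1) multiplier_relu_nonneg[of N m Q1 Q2 Q3 v w k, OF Q1 Q2 Q3 Q30 vw(1,3)]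
      by (intro lmi_dissipation[OF G Fd Pc M \<epsilon>(2) _ sys \<psi>c \<psi>(2) fir]) auto
    have tele: "V T + (\<Sum>k<T. e k \<bullet> e k) + \<epsilon> * (\<Sum>k<T. x k \<bullet> x k)
        \<le> V 0 + (g - \<epsilon>) * (\<Sum>k<T. d k \<bullet> d k)"
    proof (induction T)
      case (Suc T)
      then show ?case using step[of T] by (simp add: distrib_left)
    qed simp
    \<comment> \<open>The filter starts at rest, so the initial storage is controlled by the plant
      state alone.\<close>
    have "V 0 \<le> c * ((x 0 @\<^sub>v \<psi> 0) \<bullet> (x 0 @\<^sub>v \<psi> 0))"
      using c(2)[of "x 0 @\<^sub>v \<psi> 0"] x \<psi>c by (simp add: V_def)
    also have "\<dots> = c * (x 0 \<bullet> x 0)"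
      by (simp add: \<psi>(1) scalar_prod_append_dim)
    finally have "V 0 \<le> c * (x 0 \<bullet> x 0)" .
    \<comment> \<open>Positive semidefiniteness of \<open>P\<close> allows the final storage to be
      dropped.\<close>
    moreover have "0 \<le> V T" unfolding V_def using x \<psi>c by (intro Ppos) simp
    ultimately show "(\<Sum>k<T. e k \<bullet> e k) + \<epsilon> * (\<Sum>k<T. x k \<bullet> x k)
        \<le> c * (x 0 \<bullet> x 0) + (g - \<epsilon>) * (\<Sum>k<T. d k \<bullet> d k)"
      using tele by simp
  qed
qed

section \<open>Internal stability and induced gain\<close>

text \<open>A bound on all partial sums makes the squares of the state summable, which gives
  attractivity; since each square is at most a partial sum, it gives Lyapunov stability too.\<close>

lemma internally_stable_if_energy_bound:
  assumes "c > 0"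
    and bound: "\<And>x v w e T. interconnection nx m nd ne G (\<lambda>k. 0\<^sub>v nd) x v w e \<Longrightarrow>
      (\<Sum>k<T. x k \<bullet> x k) \<le> c * (x 0 \<bullet> x 0)"
  shows "internally_stable nx m nd ne G"
  unfolding internally_stable_def
proof (intro conjI allI impI)
  fix x v w e assume "interconnection nx m nd ne G (\<lambda>k. 0\<^sub>v nd) x v w e"
  from bound[OF this] have "summable (\<lambda>k. x k \<bullet> x k)"
    by (intro summableI_nonneg_bounded scalar_prod_self_nonneg)
  from tendsto_real_sqrt[OF summable_LIMSEQ_zero[OF this]]
  show "(\<lambda>k. eucl_norm (x k)) \<longlonglongrightarrow> 0" by (simp add: eucl_norm_def)
next
  fix \<epsilon> :: real assume "\<epsilon> > 0"
  show "\<exists>\<delta>>0. \<forall>x v w e. interconnection nx m nd ne G (\<lambda>k. 0\<^sub>v nd) x v w e \<longrightarrow>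
        eucl_norm (x 0) < \<delta> \<longrightarrow> (\<forall>k. eucl_norm (x k) < \<epsilon>)"
  \<comment> \<open>The norm of the state never exceeds \<open>sqrt c\<close> times its initial
    value, so dividing \<epsilon> by that factor gives the radius.\<close>
  proof (intro exI[of _ "\<epsilon> / sqrt c"] conjI allI impI)
    show "\<epsilon> / sqrt c > 0" using \<open>\<epsilon> > 0\<close> \<open>c > 0\<close> by simp
    fix x v w e k
    assume sys: "interconnection nx m nd ne G (\<lambda>k. 0\<^sub>v nd) x v w e"
      and x0: "eucl_norm (x 0) < \<epsilon> / sqrt c"
    have "x k \<bullet> x k \<le> (\<Sum>i<Suc k. x i \<bullet> x i)"
      by (intro member_le_sum) (auto simp: scalar_prod_self_nonneg)
    also have "\<dots> \<le> c * (x 0 \<bullet> x 0)" by (rule bound[OF sys])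
    finally have "eucl_norm (x k) \<le> sqrt c * eucl_norm (x 0)"
      by (simp add: eucl_norm_def flip: real_sqrt_mult)
    also have "\<dots> < \<epsilon>" using x0 \<open>c > 0\<close> by (simp add: field_simps)
    finally show "eucl_norm (x k) < \<epsilon>" .
  qed
qed

text \<open>Square summability of \<open>e\<close> is part of the conclusion: its partial sums are
  bounded by \<open>s\<close> times the total energy of \<open>d\<close>.\<close>

lemma l2_gain_bound:
  assumes d: "d \<in> l2 nd" and e: "e \<in> l2e ne" and "s \<ge> 0"
    and le: "\<And>T. (\<Sum>k<T. e k \<bullet> e k) \<le> s * (\<Sum>k<T. d k \<bullet> d k)"
  shows "e \<in> l2 ne" "l2_norm e \<le> sqrt s * l2_norm d"
proof -
  have sd: "summable (\<lambda>k. d k \<bullet> d k)" using d by (simp add: l2_def)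
  have le': "(\<Sum>k<T. e k \<bullet> e k) \<le> s * (\<Sum>k. d k \<bullet> d k)" for T
    using le[of T] mult_left_mono[OF sum_le_suminf[OF sd, of "{..<T}"] \<open>s \<ge> 0\<close>]
    by (auto simp: scalar_prod_self_nonneg)
  have se: "summable (\<lambda>k. e k \<bullet> e k)"
    by (rule summableI_nonneg_bounded[OF scalar_prod_self_nonneg le'])
  show "e \<in> l2 ne" using e se by (simp add: l2_def)
  show "l2_norm e \<le> sqrt s * l2_norm d"
    using suminf_le_const[OF se le'] by (simp add: l2_norm_def flip: real_sqrt_mult)
qed

text \<open>The gain is an infimum, so strictness follows from one admissible real bound below
  \<gamma>; the margin \<epsilon> leaves room for it.\<close>

lemma induced_gain_less_if_energy_bound:
  assumes "\<epsilon> > 0" "\<gamma> \<ge> 0"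
    and bound: "\<And>d x v w e T. interconnection nx m nd ne G d x v w e \<Longrightarrow> x 0 = 0\<^sub>v nx \<Longrightarrow>
      (\<Sum>k<T. e k \<bullet> e k) \<le> (\<gamma>\<^sup>2 - \<epsilon>) * (\<Sum>k<T. d k \<bullet> d k)"
  shows "induced_gain nx m nd ne G < ereal \<gamma>"
proof -
  have nonneg: "0 \<le> (\<Sum>k<T. u k \<bullet> u k)" for T and u :: signal
    by (intro sum_nonneg scalar_prod_self_nonneg)
  have "\<exists>s<\<gamma>. \<forall>d \<in> l2 nd. \<forall>x v w e. interconnection nx m nd ne G d x v w e \<longrightarrow> x 0 = 0\<^sub>v nx \<longrightarrow>
            e \<in> l2 ne \<and> l2_norm e \<le> s * l2_norm d"
  proof (cases "\<gamma> = 0")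
    case True
    \<comment> \<open>The energy bound then forces \<open>d = 0\<close> and \<open>e = 0\<close>, so even \<open>-1\<close> is an admissible gain.\<close>
    show ?thesis
    proof (intro exI[of _ "-1"] conjI ballI allI impI)
      show "-1 < \<gamma>" using True by simp
      fix d x v w e assume d: "d \<in> l2 nd"
        and sys: "interconnection nx m nd ne G d x v w e" "x 0 = 0\<^sub>v nx"
      have le: "(\<Sum>k<T. e k \<bullet> e k) + \<epsilon> * (\<Sum>k<T. d k \<bullet> d k) \<le> 0" for T
        using bound[OF sys, of T] True by simp
      have zero: "(\<Sum>k<T. e k \<bullet> e k) = 0 \<and> (\<Sum>k<T. d k \<bullet> d k) = 0" for T
        using le[of T] nonneg[of e T] nonneg[of d T] \<open>\<epsilon> > 0\<close>
          mult_nonneg_nonneg[of \<epsilon> "\<Sum>k<T. d k \<bullet> d k"]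
        by (smt (verit) mult_pos_pos)
      \<comment> \<open>Each term is a difference of two consecutive partial sums, all of which
        vanish.\<close>
      have d0: "d k \<bullet> d k = 0" and e0: "e k \<bullet> e k = 0" for k
        using zero[of k] zero[of "Suc k"] by auto
      show "e \<in> l2 ne" using sys e0 by (simp add: l2_def interconnection_def)
      show "l2_norm e \<le> - 1 * l2_norm d" by (simp add: l2_norm_def d0 e0)
    qed
  next
    case False
    \<comment> \<open>Truncating the margin at \<open>\<gamma>\<^sup>2\<close> keeps
      \<open>s\<close> non-negative, so that \<open>sqrt s\<close> can serve as the bound;
      \<open>s\<close> stays below \<open>\<gamma>\<^sup>2\<close> because \<gamma> is nonzero
      here.\<close>
    define s where "s = \<gamma>\<^sup>2 - min \<epsilon> (\<gamma>\<^sup>2)"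
    have s: "0 \<le> s" "s < \<gamma>\<^sup>2" using False \<open>\<epsilon> > 0\<close> by (auto simp: s_def min_def)
    show ?thesis
    proof (intro exI[of _ "sqrt s"] conjI ballI allI impI)
      show "sqrt s < \<gamma>" using s(2) \<open>\<gamma> \<ge> 0\<close> by (simp add: real_less_lsqrt s(1))
      fix d x v w e assume d: "d \<in> l2 nd"
        and sys: "interconnection nx m nd ne G d x v w e" "x 0 = 0\<^sub>v nx"
      have e: "e \<in> l2e ne" using sys by (simp add: interconnection_def)
      have "(\<gamma>\<^sup>2 - \<epsilon>) * (\<Sum>k<T. d k \<bullet> d k) \<le> s * (\<Sum>k<T. d k \<bullet> d k)" for T
        by (intro mult_right_mono nonneg) (simp add: s_def)
      then have le: "(\<Sum>k<T. e k \<bullet> e k) \<le> s * (\<Sum>k<T. d k \<bullet> d k)" for T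
        using bound[OF sys, of T] order_trans by blast
      show "e \<in> l2 ne" "l2_norm e \<le> sqrt s * l2_norm d"
        using l2_gain_bound[OF d e s(1) le] by auto
    qed
  qed
  then obtain s where "s < \<gamma>" and s: "ereal s \<in> {ereal \<gamma> | \<gamma>. \<forall>d \<in> l2 nd. \<forall>x v w e.
            interconnection nx m nd ne G d x v w e \<longrightarrow> x 0 = 0\<^sub>v nx \<longrightarrow>
            e \<in> l2 ne \<and> l2_norm e \<le> \<gamma> * l2_norm d}"
    by blast
  have "induced_gain nx m nd ne G \<le> ereal s"
    unfolding induced_gain_def by (rule Inf_lower[OF s])
  also have "\<dots> < ereal \<gamma>" using \<open>s < \<gamma>\<close> by simp
  finally show ?thesis .
qed

section \<open>Stability and gain bound from the matrix inequality\<close>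

theorem corollary1:
  fixes nx m nd ne np N :: nat
    and G :: lti
    and F :: filter_ss
    and Q1 Q2 :: "nat \<Rightarrow> real mat"
    and Q3 :: "int \<Rightarrow> real mat"
    and \<gamma> :: real
  assumes "lti_dims nx m nd ne G"
    and "well_posed nx m nd G"
    and "realizes_fir np m N F"
    and "\<And>i. i \<le> N \<Longrightarrow> nonneg_square_mat m (Q1 i) \<and> sym_mat m (Q1 i)"
    and "\<And>i. i \<le> N \<Longrightarrow> nonneg_square_mat m (Q2 i) \<and> sym_mat m (Q2 i)"
    and "\<And>i. - int N \<le> i \<Longrightarrow> i \<le> int N \<Longrightarrow> i \<noteq> 0 \<Longrightarrow> nonneg_square_mat m (Q3 i)"
    and "Metzler_mat m (Q3 0)"
    and "0 \<le> \<gamma>"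
    and "\<exists>P. psd_mat (nx + np) P \<and>
          negdef_mat (nx + np + m + nd) (lmi_mat G F P (multiplier m N Q1 Q2 Q3) (\<gamma>\<^sup>2))"
  shows "internally_stable nx m nd ne G \<and> induced_gain nx m nd ne G < ereal \<gamma>"
proof -
  from assms(9) obtain P where P: "psd_mat (nx + np) P"
    and lmi: "negdef_mat (nx + np + m + nd) (lmi_mat G F P (multiplier m N Q1 Q2 Q3) (\<gamma>\<^sup>2))"
    by blast
  have Q1: "\<And>i. i \<le> N \<Longrightarrow> nonneg_square_mat m (Q1 i)"
    and Q2: "\<And>i. i \<le> N \<Longrightarrow> nonneg_square_mat m (Q2 i)"
    using assms(4,5) by simp_all
  obtain \<epsilon> c where \<epsilon>: "\<epsilon> > 0" and c: "c > 0"
    and bound: "\<And>d x v w e T. interconnection nx m nd ne G d x v w e \<Longrightarrow>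
      (\<Sum>k<T. e k \<bullet> e k) + \<epsilon> * (\<Sum>k<T. x k \<bullet> x k)
        \<le> c * (x 0 \<bullet> x 0) + (\<gamma>\<^sup>2 - \<epsilon>) * (\<Sum>k<T. d k \<bullet> d k)"
    using energy_bound[OF assms(1,3) Q1 Q2 assms(6,7) P lmi] by blast
  have nonneg: "0 \<le> (\<Sum>k<T. u k \<bullet> u k)" for T and u :: signal
    by (intro sum_nonneg scalar_prod_self_nonneg)
  have "internally_stable nx m nd ne G"
  proof (rule internally_stable_if_energy_bound)
    \<comment> \<open>Without disturbance the output energy is dropped, and dividing by \<epsilon>
      leaves this constant.\<close>
    show "c / \<epsilon> > 0" using c \<epsilon> by simp
    fix x v w e T assume "interconnection nx m nd ne G (\<lambda>k. 0\<^sub>v nd) x v w e"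
    from bound[OF this, of T] nonneg[of e T]
    have "\<epsilon> * (\<Sum>k<T. x k \<bullet> x k) \<le> c * (x 0 \<bullet> x 0)" by simp
    then show "(\<Sum>k<T. x k \<bullet> x k) \<le> c / \<epsilon> * (x 0 \<bullet> x 0)"
      using \<epsilon> by (simp add: field_simps)
  qed
  moreover have "induced_gain nx m nd ne G < ereal \<gamma>"
  proof (rule induced_gain_less_if_energy_bound[OF \<epsilon> assms(8)])
    fix d x v w e T assume "interconnection nx m nd ne G d x v w e" "x 0 = 0\<^sub>v nx"
    \<comment> \<open>From the zero state the initial term vanishes, and the state energy on the
      left is dropped as non-negative.\<close>
    from bound[OF this(1), of T] this(2) mult_nonneg_nonneg[OF less_imp_le[OF \<epsilon>] nonneg[of x T]]
    show "(\<Sum>k<T. e k \<bullet> e k) \<le> (\<gamma>\<^sup>2 - \<epsilon>) * (\<Sum>k<T. d k \<bullet> d k)" by simp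
  qed
  ultimately show ?thesis ..
qed

end
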